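(* Let $\mathbb{Q}_{\mathrm{o}}^+$ denote the set of positive rational numbers with odd numerator when reduced to lowest terms. For every $\kappa\in\pi\,\mathbb{Q}_{\mathrm{o}}^+$ and every $N\in\mathbb{N}$ there exists $\Lambda\in\mathcal{U}$ such that $|M(\Lambda)|=N$ and $0\notin M(\Lambda)$.
   Context: Here $\mathbb{N}=\{1,2,\dots\}$ and $\kappa>0$ is a wavenumber on which $M$ depends. Let $\mathcal{U}=\{(\mu,\alpha,\lambda)\in\mathbb{R}^3:\mu\neq0,\ \alpha<0,\ 0<\lambda<\pi\}$. For $n\in\mathbb{N}_0$ and $\alpha<0$ set $\theta_n=\theta(n,\alpha)=\sqrt{\alpha+n^2\kappa^2}$, which equals $\sqrt{n^2\kappa^2-|\alpha|}$ if $n\ge|\alpha|^{1/2}/\kappa$ and $i\sqrt{|\alpha|-n^2\kappa^2}$ if $n<|\alpha|^{1/2}/\kappa$. Set $l(n,\alpha)=\theta_n\coth(\theta_n)$ (interpreted by continuity as $1$ when $\theta_n=0$, equal to $|\theta_n|\cot|\theta_n|$ when $\theta_n$ is imaginary, and well-defined whenever $\sinh(\theta_n)/\theta_n\neq0$, with $\sinh(\theta_n)/\theta_n:=1$ if $\theta_n=0$), and for $\Lambda=(\mu,\alpha,\lambda)\in\mathcal{U}$ set $$r(\Lambda)=\frac{1}{\mu^2|\alpha|\sin^2(\lambda)}+|\alpha|^{1/2}\cot(\lambda).$$ $M(\Lambda)$ is the (finite) set of all $n\in\mathbb{N}_0$ for which $l(n,\alpha)$ is well-defined and satisfies the kernel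 equation $l(n,\alpha)=r(\Lambda)$. *)

theory Defs
  imports "HOL-Analysis.Analysis"
begin

(* The third parameter, lambda in the source, is written \<phi> because the symbol for lambda
   is reserved for abstraction. *)
definition U :: "(real \<times> real \<times> real) set" where
  "U = {(\<mu>, \<alpha>, \<phi>). \<mu> \<noteq> 0 \<and> \<alpha> < 0 \<and> 0 < \<phi> \<and> \<phi> < pi}"

(* csqrt is the principal branch: it is sqrt x at a real x >= 0 and
   i * sqrt |x| at a real x < 0. *)
definition \<theta> :: "real \<Rightarrow> nat \<Rightarrow> real \<Rightarrow> complex" where
  "\<theta> \<kappa> n \<alpha> = csqrt (complex_of_real (\<alpha> + (real n)\<^sup>2 * \<kappa>\<^sup>2))"

definition l_defined :: "real \<Rightarrow> nat \<Rightarrow> real \<Rightarrow> bool" where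
  "l_defined \<kappa> n \<alpha> \<longleftrightarrow>
     (if \<theta> \<kappa> n \<alpha> = 0 then 1 else sinh (\<theta> \<kappa> n \<alpha>) / \<theta> \<kappa> n \<alpha>) \<noteq> 0"

(* z * coth z at z = \<theta> \<kappa> n \<alpha>, extended by continuity at z = 0. Its value is real, but it
   is formed in complex because \<theta> may be imaginary. It is meaningful only under l_defined;
   elsewhere it is 0 as a result of division by zero. *)
definition l_ker :: "real \<Rightarrow> nat \<Rightarrow> real \<Rightarrow> complex" where
  "l_ker \<kappa> n \<alpha> =
     (if \<theta> \<kappa> n \<alpha> = 0 then 1
      else \<theta> \<kappa> n \<alpha> * (cosh (\<theta> \<kappa> n \<alpha>) / sinh (\<theta> \<kappa> n \<alpha>)))"

definition r_ker :: "real \<times> real \<times> real \<Rightarrow> real" where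
  "r_ker = (\<lambda>(\<mu>, \<alpha>, \<phi>). 1 / (\<mu>\<^sup>2 * \<bar>\<alpha>\<bar> * (sin \<phi>)\<^sup>2) + sqrt \<bar>\<alpha>\<bar> * cot \<phi>)"

definition M :: "real \<Rightarrow> real \<times> real \<times> real \<Rightarrow> nat set" where
  "M \<kappa> = (\<lambda>(\<mu>, \<alpha>, \<phi>).
     {n. l_defined \<kappa> n \<alpha> \<and> l_ker \<kappa> n \<alpha> = complex_of_real (r_ker (\<mu>, \<alpha>, \<phi>))})"

(* quotient_of gives the coprime (numerator, denominator) with positive denominator. *)
definition Q_odd_pos :: "rat set" where
  "Q_odd_pos = {q. q > 0 \<and> odd (fst (quotient_of q))}"

end

theory Submission
  imports Defs
begin

text \<open>
  The parameters are chosen so that the right-hand side \<^term>\<open>r_ker (\<mu>, \<alpha>, \<phi>)\<close> vanishes: with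
  \<open>\<phi> = 3 * pi / 4\<close> the cotangent is \<open>-1\<close>, and a suitable \<open>\<mu>\<close> cancels it, whatever \<open>\<alpha> < 0\<close> is.
  The kernel equation \<open>\<theta> coth \<theta> = 0\<close> has no solution with real \<open>\<theta>\<close>, and for imaginary
  \<open>\<theta> = \<i> s\<close> it says \<open>cos s = 0\<close>, so \<open>s\<close> is an odd multiple of \<open>pi / 2\<close>. Hence \<open>n\<close> lies in \<open>M\<close>
  iff \<open>-\<alpha> = n\<^sup>2 \<kappa>\<^sup>2 + (pi / 2 * y)\<^sup>2\<close> for some odd \<open>y\<close> (lemma \<open>kernel_zero_iff\<close>), and \<open>\<alpha>\<close> is still free.

  Write \<open>\<kappa> = pi * p / q\<close> in lowest terms and take \<open>-\<alpha> = (pi * p / 2)\<^sup>2 * 5 ^ t\<close>. Clearing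
  denominators gives \<open>(2 n p)\<^sup>2 + (q y)\<^sup>2 = (q p)\<^sup>2 * 5 ^ t\<close>. Divisibility forces \<open>q\<close> to divide
  \<open>2 n\<close> and \<open>p\<close> to divide \<open>y\<close>, which leaves \<open>x\<^sup>2 + z\<^sup>2 = 5 ^ t\<close> with \<open>2 n = q x\<close> and
  \<open>y = p z\<close>. Because \<open>p\<close> is odd, \<open>y\<close> is odd exactly when \<open>z\<close> is, that is, exactly when \<open>x\<close> is
  even (lemma \<open>rational_wavenumber_leg_iff\<close>). So \<open>M\<close> is in bijection with the even \<open>x\<close> that occur in
  a representation of \<open>5 ^ t\<close> as a sum of two squares.

  There are exactly \<open>N\<close> of these, all nonzero, when \<open>t = 2 * N - 1\<close> (lemma
  \<open>even_legs_odd_power\<close>): the representations with \<open>x\<close> divisible by 5 are 5 times those of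
  \<open>5 ^ (t - 2)\<close>, and exactly one even \<open>x\<close> is not divisible by 5. The latter comes from
  the powers of the Gaussian integer \<open>2 + \<i>\<close>, and it is unique by the identity of Brahmagupta.
\<close>

section \<open>Even legs in representations of powers of 5 as sums of two squares\<close>

definition even_legs :: "nat \<Rightarrow> nat set" where
  "even_legs t = {x. even x \<and> (\<exists>y. x\<^sup>2 + y\<^sup>2 = 5 ^ t)}"

lemma brahmagupta_sum_of_squares:
  fixes a b c d :: "'a::comm_ring_1"
  shows "(a\<^sup>2 + b\<^sup>2) * (c\<^sup>2 + d\<^sup>2) = (a * d - b * c)\<^sup>2 + (a * c + b * d)\<^sup>2"
  by (simp add: power2_eq_square algebra_simps)

text \<open>A multiple of \<open>n\<close> whose square is smaller than \<open>n\<^sup>2\<close> is zero.\<close>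

lemma leg_divisible_by_hypotenuse_trivial:
  fixes n e f :: int
  assumes "n > 0" "e\<^sup>2 + f\<^sup>2 = n\<^sup>2" "n dvd e"
  shows "e = 0 \<or> f = 0"
proof (rule disjCI)
  assume "f \<noteq> 0"
  then have "f\<^sup>2 > 0" by simp
  with assms(2) have "e\<^sup>2 < n\<^sup>2" by linarith
  then have "\<bar>e\<bar> < \<bar>n\<bar>" using power2_less_imp_less[of "\<bar>e\<bar>" "\<bar>n\<bar>"] by simp
  with assms(3) show "e = 0"
    using dvd_imp_le_int by force
qed

text \<open>Two parallel vectors of equal length differ at most by a sign, and the sign of the first
  coordinate is prescribed. The proof substitutes
  \<open>a d = b c\<close> into \<open>a\<^sup>2 (c\<^sup>2 + d\<^sup>2)\<close>, which turns it into \<open>(a\<^sup>2 + b\<^sup>2) c\<^sup>2\<close>.\<close>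

lemma proportional_legs_eq:
  fixes a b c d :: int
  assumes "a \<ge> 0" "c \<ge> 0" "a\<^sup>2 + b\<^sup>2 = n" "c\<^sup>2 + d\<^sup>2 = n" "n > 0" "a * d = b * c"
  shows "a = c"
proof -
  have "a\<^sup>2 * n = a\<^sup>2 * c\<^sup>2 + (a * d)\<^sup>2"
    unfolding assms(4)[symmetric] by (simp add: algebra_simps power_mult_distrib)
  also have "\<dots> = n * c\<^sup>2"
    unfolding assms(6) unfolding assms(3)[symmetric] by (simp add: algebra_simps power_mult_distrib)
  finally have "a\<^sup>2 = c\<^sup>2" using assms(5) by simp
  then show ?thesis using assms(1,2) by (simp add: power2_eq_iff_nonneg)
qed

lemma five_dvd_leg_iff:
  fixes x y :: int
  assumes "x\<^sup>2 + y\<^sup>2 = 5 ^ Suc t"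
  shows "5 dvd x \<longleftrightarrow> 5 dvd y"
proof -
  have p: "prime (5::int)" by simp
  have "5 dvd x\<^sup>2 + y\<^sup>2" using assms by simp
  then have "5 dvd x\<^sup>2 \<longleftrightarrow> 5 dvd y\<^sup>2"
    by (metis dvd_add_left_iff dvd_add_right_iff)
  then show ?thesis using p prime_dvd_power_iff[of "5::int" 2] by simp
qed

text \<open>Let \<open>n = 5 ^ Suc t\<close>. The product of \<open>a d - b c\<close> and \<open>a d + b c\<close> is a multiple of \<open>n\<close>, while
  their sum \<open>2 a d\<close> is prime to 5, so \<open>n\<close> divides one of the two factors. By the
  identity of Brahmagupta that factor is a leg of a right triangle with hypotenuse \<open>n\<close>, so the
  triangle is degenerate. By positivity this means that \<open>(a, b)\<close> is parallel to \<open>(c, d)\<close> or to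
  \<open>(d, c)\<close>; parity excludes the second.\<close>

lemma primitive_leg_unique_int:
  fixes a b c d :: int
  assumes nonneg: "a > 0" "b > 0" "c > 0" "d > 0"
    and ab: "a\<^sup>2 + b\<^sup>2 = 5 ^ Suc t" and cd: "c\<^sup>2 + d\<^sup>2 = 5 ^ Suc t"
    and prim: "\<not> 5 dvd a" "\<not> 5 dvd c"
    and par: "even a" "even c"
  shows "a = c"
proof -
  let ?n = "5 ^ Suc t :: int"
  have n: "?n > 0" by simp
  have p: "prime (5::int)" by simp
  have prim': "\<not> 5 dvd d" using five_dvd_leg_iff[OF cd] prim by simp
  have odd_d: "odd d"
  proof
    assume "even d"
    then have "even (c\<^sup>2 + d\<^sup>2)" using par by simp
    then show False unfolding cd by simp
  qed
  have prod: "(a * d - b * c) * (a * d + b * c) = ?n * (a\<^sup>2 - c\<^sup>2)"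
  proof -
    have "(a * d - b * c) * (a * d + b * c) = a\<^sup>2 * d\<^sup>2 - b\<^sup>2 * c\<^sup>2"
      by (simp add: power2_eq_square algebra_simps)
    also have "d\<^sup>2 = ?n - c\<^sup>2" using cd by simp
    also have "b\<^sup>2 = ?n - a\<^sup>2" using ab by simp
    finally show ?thesis by (simp only: algebra_simps)
  qed
  have not_both: "\<not> (5 dvd a * d - b * c \<and> 5 dvd a * d + b * c)"
  proof
    assume "5 dvd a * d - b * c \<and> 5 dvd a * d + b * c"
    then have "5 dvd (a * d - b * c) + (a * d + b * c)" by (blast intro: dvd_add)
    then have "5 dvd 2 * (a * d)" by simp
    then have "5 dvd a * d" by presburger
    then show False using p prim prim' prime_dvd_multD by blast
  qed
  have cop: "coprime ?n z" if "\<not> 5 dvd z" for z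
    using prime_imp_coprime[OF p that] by (simp only: coprime_power_left_iff simp_thms)
  have "?n dvd (a * d - b * c) * (a * d + b * c)" unfolding prod by simp
  then have "?n dvd a * d - b * c \<or> ?n dvd a * d + b * c"
    using not_both coprime_dvd_mult_left_iff[OF cop] coprime_dvd_mult_right_iff[OF cop] by blast
  then show ?thesis
  proof
    assume dv: "?n dvd a * d - b * c"
    have "(a * d - b * c)\<^sup>2 + (a * c + b * d)\<^sup>2 = ?n\<^sup>2"
      using brahmagupta_sum_of_squares[of a b c d] unfolding ab cd by (simp add: power2_eq_square)
    from leg_divisible_by_hypotenuse_trivial[OF n this dv]
    have "a * d - b * c = 0 \<or> a * c + b * d = 0" .
    moreover have "a * c + b * d > 0" using nonneg by (simp add: add_pos_pos)
    ultimately have "a * d = b * c" by simp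
    then show ?thesis using proportional_legs_eq[OF _ _ ab cd n] nonneg by simp
  next
    assume dv: "?n dvd a * d + b * c"
    have "(a * d + b * c)\<^sup>2 + (a * c - b * d)\<^sup>2 = ?n\<^sup>2"
      using brahmagupta_sum_of_squares[of a "- b" c d] ab cd by (simp add: power2_eq_square)
    from leg_divisible_by_hypotenuse_trivial[OF n this dv]
    have "a * d + b * c = 0 \<or> a * c - b * d = 0" .
    moreover have "a * d + b * c > 0" using nonneg by (simp add: add_pos_pos)
    ultimately have "a * c = b * d" by simp
    moreover have dc: "d\<^sup>2 + c\<^sup>2 = 5 ^ Suc t" using cd by simp
    ultimately have "a = d" using proportional_legs_eq[OF _ _ ab dc n] nonneg by simp
    then show ?thesis using par odd_d by simp
  qed
qed

text \<open>These are the real and imaginary parts of \<open>(2 + \<i>) ^ Suc t\<close>. The congruence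
  \<open>u = 2 v\<close> modulo 5 is what makes the induction go through: multiplication by \<open>2 + \<i>\<close>
  preserves it and sends \<open>v\<close> to \<open>u + 2 v\<close>, which is congruent to \<open>4 v\<close>.\<close>

lemma primitive_leg_exists_int:
  "\<exists>u v :: int. u\<^sup>2 + v\<^sup>2 = 5 ^ Suc t \<and> 5 dvd u - 2 * v \<and> \<not> 5 dvd v"
proof (induction t)
  case 0
  show ?case by (rule exI[of _ 2], rule exI[of _ 1]) simp
next
  case (Suc t)
  then obtain u v :: int where uv: "u\<^sup>2 + v\<^sup>2 = 5 ^ Suc t" "5 dvd u - 2 * v" "\<not> 5 dvd v"
    by blast
  have "(2 * u - v)\<^sup>2 + (u + 2 * v)\<^sup>2 = 5 * (u\<^sup>2 + v\<^sup>2)"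
    by (simp add: power2_eq_square algebra_simps)
  also have "\<dots> = 5 ^ Suc (Suc t)" unfolding uv(1) by simp
  finally have "(2 * u - v)\<^sup>2 + (u + 2 * v)\<^sup>2 = 5 ^ Suc (Suc t)" .
  moreover have "5 dvd (2 * u - v) - 2 * (u + 2 * v)" by presburger
  moreover have "\<not> 5 dvd u + 2 * v" using uv(2,3) by presburger
  ultimately show ?case by blast
qed

text \<open>The sum of the two squares is odd, so one of the two legs is even; neither is divisible by 5.\<close>

lemma primitive_even_leg_exists:
  "\<exists>x\<in>even_legs (Suc t). \<not> 5 dvd x"
proof -
  obtain u v :: int where uv: "u\<^sup>2 + v\<^sup>2 = 5 ^ Suc t" "5 dvd u - 2 * v" "\<not> 5 dvd v"
    using primitive_leg_exists_int by blast
  have nat_eq: "(nat \<bar>a\<bar>)\<^sup>2 + (nat \<bar>b\<bar>)\<^sup>2 = 5 ^ Suc t"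
    if "a\<^sup>2 + b\<^sup>2 = 5 ^ Suc t" for a b :: int
  proof -
    have "int ((nat \<bar>a\<bar>)\<^sup>2 + (nat \<bar>b\<bar>)\<^sup>2) = int (5 ^ Suc t)" using that by simp
    then show ?thesis by (simp only: of_nat_eq_iff)
  qed
  have u: "\<not> 5 dvd u" using uv(2,3) by presburger
  have ndvd: "\<not> 5 dvd nat \<bar>a\<bar>" if "\<not> 5 dvd a" for a :: int
    using that by (simp add: dvd_nat_abs_iff)
  have ev: "even (nat \<bar>a\<bar>)" if "even a" for a :: int
    using that by (simp add: even_nat_iff)
  have "odd (u\<^sup>2 + v\<^sup>2)" unfolding uv(1) by simp
  then consider "even u" | "even v" by auto
  then show ?thesis
  proof cases
    case 1
    then show ?thesis using nat_eq[OF uv(1)] ndvd[OF u] ev unfolding even_legs_def by blast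
  next
    case 2
    have "v\<^sup>2 + u\<^sup>2 = 5 ^ Suc t" using uv(1) by simp
    from 2 nat_eq[OF this] ndvd[OF uv(3)] ev show ?thesis unfolding even_legs_def by blast
  qed
qed

lemma primitive_even_leg_unique:
  assumes "a \<in> even_legs (Suc t)" "c \<in> even_legs (Suc t)" "\<not> 5 dvd a" "\<not> 5 dvd c"
  shows "a = c"
proof -
  obtain b d where b: "a\<^sup>2 + b\<^sup>2 = 5 ^ Suc t" and d: "c\<^sup>2 + d\<^sup>2 = 5 ^ Suc t"
    and par: "even a" "even c"
    using assms unfolding even_legs_def by blast
  have bi: "(int a)\<^sup>2 + (int b)\<^sup>2 = 5 ^ Suc t"
    using arg_cong[OF b, of int] by simp
  have di: "(int c)\<^sup>2 + (int d)\<^sup>2 = 5 ^ Suc t"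
    using arg_cong[OF d, of int] by simp
  have na: "\<not> 5 dvd int a" "\<not> 5 dvd int c"
    using assms(3,4) by presburger+
  have "\<not> 5 dvd int b" "\<not> 5 dvd int d"
    using five_dvd_leg_iff[OF bi] five_dvd_leg_iff[OF di] na by auto
  then have "int a > 0" "int b > 0" "int c > 0" "int d > 0"
    using na by (auto intro!: Nat.gr0I)
  from primitive_leg_unique_int[OF this bi di na] par show ?thesis by simp
qed

lemma even_legs_imprimitive:
  "{x \<in> even_legs (Suc (Suc t)). 5 dvd x} = (*) 5 ` even_legs t"
proof (intro equalityI subsetI)
  fix x assume "x \<in> {x \<in> even_legs (Suc (Suc t)). 5 dvd x}"
  then obtain y where y: "x\<^sup>2 + y\<^sup>2 = 5 ^ Suc (Suc t)" and x: "even x" "5 dvd x"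
    unfolding even_legs_def by blast
  have "(int x)\<^sup>2 + (int y)\<^sup>2 = 5 ^ Suc (Suc t)"
    using arg_cong[OF y, of int] by simp
  from five_dvd_leg_iff[OF this] x(2) have "5 dvd y" by presburger
  then obtain x' y' where eq: "x = 5 * x'" "y = 5 * y'" using x(2) by (auto elim!: dvdE)
  then have "x'\<^sup>2 + y'\<^sup>2 = 5 ^ t" using y by (simp add: power_mult_distrib)
  moreover have "even x'" using x(1) eq by simp
  ultimately show "x \<in> (*) 5 ` even_legs t" using eq unfolding even_legs_def by blast
next
  fix x assume "x \<in> (*) 5 ` even_legs t"
  then obtain x' y' where x': "x = 5 * x'" "even x'" "x'\<^sup>2 + y'\<^sup>2 = 5 ^ t"
    unfolding even_legs_def by blast
  have "x\<^sup>2 + (5 * y')\<^sup>2 = 25 * (x'\<^sup>2 + y'\<^sup>2)" unfolding x'(1) by (simp add: power_mult_distrib)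
  then have "x\<^sup>2 + (5 * y')\<^sup>2 = 5 ^ Suc (Suc t)" unfolding x'(3) by simp
  then have "\<exists>y. x\<^sup>2 + y\<^sup>2 = 5 ^ Suc (Suc t)" by (rule exI)
  moreover have "even x" "5 dvd x" using x'(1,2) by simp_all
  ultimately show "x \<in> {x \<in> even_legs (Suc (Suc t)). 5 dvd x}"
    unfolding even_legs_def mem_Collect_eq by (intro conjI)
qed

lemma even_legs_primitive_singleton:
  obtains c where "{x \<in> even_legs (Suc t). \<not> 5 dvd x} = {c}"
proof -
  obtain c where c: "c \<in> even_legs (Suc t)" "\<not> 5 dvd c"
    using primitive_even_leg_exists by blast
  have "x = c" if "x \<in> even_legs (Suc t)" "\<not> 5 dvd x" for x
    using primitive_even_leg_unique that c by blast
  with c show thesis by (intro that[of c]) blast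
qed

lemma even_legs_Suc_Suc:
  obtains c where "\<not> 5 dvd c" "even_legs (Suc (Suc t)) = insert c ((*) 5 ` even_legs t)"
proof -
  obtain c where c: "{x \<in> even_legs (Suc (Suc t)). \<not> 5 dvd x} = {c}"
    by (rule even_legs_primitive_singleton)
  have "even_legs (Suc (Suc t)) = {x \<in> even_legs (Suc (Suc t)). \<not> 5 dvd x} \<union> {x \<in> even_legs (Suc (Suc t)). 5 dvd x}"
    by blast
  then have "even_legs (Suc (Suc t)) = insert c ((*) 5 ` even_legs t)"
    unfolding even_legs_imprimitive c by simp
  moreover have "\<not> 5 dvd c" using c by blast
  ultimately show ?thesis using that by blast
qed

lemma even_legs_one: "even_legs 1 = {2}"
proof (intro equalityI subsetI)
  fix x assume "x \<in> even_legs 1"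
  then obtain y where xy: "even x" "x\<^sup>2 + y\<^sup>2 = 5" unfolding even_legs_def by auto
  then have "x\<^sup>2 < 3\<^sup>2" "y\<^sup>2 < 3\<^sup>2" by simp_all
  then have "x < 3" "y < 3" using power_less_imp_less_base by blast+
  then have "x \<in> {0, 1, 2}" "y \<in> {0, 1, 2}" by auto
  with xy show "x \<in> {2}" by auto
next
  fix x :: nat assume "x \<in> {2}"
  then show "x \<in> even_legs 1" unfolding even_legs_def by (auto intro!: exI[of _ 1])
qed

text \<open>Passing from \<open>t\<close> to \<open>t + 2\<close> adds one primitive leg to the multiples by 5 of the
  earlier ones. The claim about 0 is inherited in the same way; it expresses that an odd
  power of 5 is not a square.\<close>

lemma even_legs_odd_power:
  "finite (even_legs (2 * j + 1)) \<and> card (even_legs (2 * j + 1)) = Suc j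
    \<and> 0 \<notin> even_legs (2 * j + 1)"
proof (induction j)
  case 0
  show ?case using even_legs_one by simp
next
  case (Suc j)
  obtain c where c: "\<not> 5 dvd c"
    "even_legs (Suc (Suc (2 * j + 1))) = insert c ((*) 5 ` even_legs (2 * j + 1))"
    by (rule even_legs_Suc_Suc)
  have "card ((*) 5 ` even_legs (2 * j + 1)) = Suc j"
    using Suc by (subst card_image) (auto simp: inj_on_def)
  moreover have "c \<notin> (*) 5 ` even_legs (2 * j + 1)" using c(1) by auto
  moreover have "c \<noteq> 0" using c(1) by (metis dvd_0_right)
  moreover have "2 * Suc j + 1 = Suc (Suc (2 * j + 1))" by simp
  ultimately show ?case using Suc c(2) by auto
qed

section \<open>The kernel equation with vanishing right-hand side\<close>

text \<open>For real \<open>\<theta> \<noteq> 0\<close> the number \<open>\<theta> coth \<theta>\<close> is nonzero, and at \<open>\<theta> = 0\<close> it is 1 by continuity, so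
  a solution has \<open>\<theta> = \<i> s\<close> with \<open>s > 0\<close>. There \<open>\<theta> coth \<theta> = s cot s\<close>, which vanishes at the zeros
  of the cosine. The condition \<^const>\<open>l_defined\<close> excludes the zeros of the sine, where
  \<^const>\<open>l_ker\<close> is 0 only because of division by zero.\<close>

lemma kernel_zero_iff:
  "l_defined \<kappa> n \<alpha> \<and> l_ker \<kappa> n \<alpha> = 0 \<longleftrightarrow>
   (\<exists>y. odd y \<and> - \<alpha> = (real n)\<^sup>2 * \<kappa>\<^sup>2 + (pi / 2 * real y)\<^sup>2)"
proof -
  define x where "x = \<alpha> + (real n)\<^sup>2 * \<kappa>\<^sup>2"
  have th: "\<theta> \<kappa> n \<alpha> = csqrt (of_real x)" unfolding \<theta>_def x_def ..
  have rhs: "(- \<alpha> = (real n)\<^sup>2 * \<kappa>\<^sup>2 + (pi / 2 * real y)\<^sup>2) \<longleftrightarrow> - x = (pi / 2 * real y)\<^sup>2" for y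
    unfolding x_def by linarith
  have no: "\<not> (\<exists>y. odd y \<and> - x = (pi / 2 * real y)\<^sup>2)" if "x \<ge> 0"
  proof
    assume "\<exists>y. odd y \<and> - x = (pi / 2 * real y)\<^sup>2"
    then obtain y where y: "odd y" "- x = (pi / 2 * real y)\<^sup>2" by blast
    then have "y > 0" by (auto intro!: Nat.gr0I)
    then have "(pi / 2 * real y)\<^sup>2 > 0" by simp
    with y that show False by linarith
  qed
  consider "x = 0" | "x > 0" | "x < 0" by linarith
  then show ?thesis
  proof cases
    case 1
    then show ?thesis using no unfolding rhs l_ker_def th by simp
  next
    case 2
    define s where "s = sqrt x"
    have s: "s > 0" using 2 by (simp add: s_def)
    have cs: "csqrt (of_real x) = of_real s" using 2 by (simp add: s_def)
    have "cosh (complex_of_real s) = of_real (cosh s)" "sinh (complex_of_real s) = of_real (sinh s)"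
      by (simp_all add: cosh_field_def sinh_field_def flip: exp_of_real)
    then have "l_ker \<kappa> n \<alpha> \<noteq> 0"
      unfolding l_ker_def th cs using s cosh_real_pos[of s] sinh_real_pos_iff[of s] by simp
    then show ?thesis using no 2 unfolding rhs by simp
  next
    case 3
    define s where "s = sqrt (- x)"
    have s: "s > 0" "s\<^sup>2 = - x" using 3 by (simp_all add: s_def)
    have cs: "csqrt (of_real x) = \<i> * of_real s"
      using 3 unfolding s_def by (simp add: csqrt_of_real_nonpos)
    have rot: "\<i> * (\<i> * complex_of_real s) = - of_real s" by simp
    have ch: "cosh (\<i> * of_real s) = of_real (cos s)"
      by (simp add: cosh_conv_cos cos_of_real)
    have sh: "sinh (\<i> * of_real s) = \<i> * of_real (sin s)"
      by (simp add: sinh_conv_sin sin_of_real)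
    have "l_defined \<kappa> n \<alpha> \<and> l_ker \<kappa> n \<alpha> = 0 \<longleftrightarrow> sin s \<noteq> 0 \<and> cos s = 0"
      unfolding l_defined_def l_ker_def th cs ch sh using s by auto
    also have "\<dots> \<longleftrightarrow> cos s = 0" using sin_zero_norm_cos_one[of s] by auto
    also have "\<dots> \<longleftrightarrow> (\<exists>y. odd y \<and> s\<^sup>2 = (pi / 2 * real y)\<^sup>2)"
      unfolding cos_zero_iff power2_eq_iff by (auto simp: mult.commute)
    finally show ?thesis unfolding rhs s(2) .
  qed
qed

text \<open>At \<open>\<phi> = 3 * pi / 4\<close> the equation \<open>r_ker = 0\<close> reads \<open>2 / (\<mu>\<^sup>2 \<bar>\<alpha>\<bar>) = sqrt \<bar>\<alpha>\<bar>\<close>, which can be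
  solved for \<open>\<mu>\<close>.\<close>

lemma r_ker_zero:
  assumes "\<alpha> < 0"
  obtains \<mu> \<phi> where "(\<mu>, \<alpha>, \<phi>) \<in> U" "r_ker (\<mu>, \<alpha>, \<phi>) = 0"
proof -
  define a where "a = \<bar>\<alpha>\<bar>"
  have a: "a > 0" using assms by (simp add: a_def)
  define \<mu> where "\<mu> = sqrt (2 / (a * sqrt a))"
  have mu: "\<mu>\<^sup>2 = 2 / (a * sqrt a)" "\<mu> \<noteq> 0" using a by (auto simp: \<mu>_def)
  have s: "sin (3 * pi / 4) = sqrt 2 / 2"
    using sin_pi_minus[of "pi / 4"] by (simp add: sin_45)
  have c: "cos (3 * pi / 4) = - sqrt 2 / 2"
    using cos_pi_minus[of "pi / 4"] by (simp add: cos_45)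
  have "r_ker (\<mu>, \<alpha>, 3 * pi / 4) = 0"
    using a mu unfolding r_ker_def by (simp add: s c cot_def power_divide flip: a_def)
  moreover have "(\<mu>, \<alpha>, 3 * pi / 4) \<in> U" using assms mu unfolding U_def by simp
  ultimately show thesis using that by blast
qed

section \<open>Rational wavenumbers with odd numerator\<close>

text \<open>Both \<open>q\<^sup>2\<close> and \<open>p\<^sup>2\<close> can be cancelled from the equation: \<open>q\<close> divides \<open>2 n p\<close> and is coprime to
  \<open>p\<close>, and once \<open>q\<close> is gone \<open>p\<close> divides \<open>y\<close>. The oddness of \<open>p\<close> is what gives every even leg an
  odd \<open>y = p z\<close>; for even \<open>p\<close> no odd multiple of \<open>p\<close> would exist.\<close>

lemma rational_wavenumber_leg_iff:
  fixes p q n t :: nat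
  assumes "odd p" "q > 0" "coprime p q"
  shows "(\<exists>y. odd y \<and> (2 * n * p)\<^sup>2 + (q * y)\<^sup>2 = (q * p)\<^sup>2 * 5 ^ t)
    \<longleftrightarrow> (\<exists>x\<in>even_legs t. 2 * n = q * x)" (is "?L \<longleftrightarrow> ?R")
proof
  assume ?L
  then obtain y where y: "odd y" "(2 * n * p)\<^sup>2 + (q * y)\<^sup>2 = (q * p)\<^sup>2 * 5 ^ t" by blast
  have p0: "p > 0" using assms(1) by (auto intro!: Nat.gr0I)
  have "q\<^sup>2 dvd (2 * n * p)\<^sup>2 + (q * y)\<^sup>2" unfolding y(2) by (simp add: power_mult_distrib)
  then have "q\<^sup>2 dvd (2 * n * p)\<^sup>2" by (simp add: power_mult_distrib dvd_add_left_iff)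
  then have "q dvd 2 * n * p" by simp
  then have "q dvd 2 * n" using assms(3) by (simp add: coprime_commute coprime_dvd_mult_left_iff)
  then obtain x where x: "2 * n = q * x" by (auto elim: dvdE)
  have "q\<^sup>2 * ((x * p)\<^sup>2 + y\<^sup>2) = q\<^sup>2 * (p\<^sup>2 * 5 ^ t)"
    using y(2) unfolding x by (simp add: power_mult_distrib algebra_simps)
  then have xy: "(x * p)\<^sup>2 + y\<^sup>2 = p\<^sup>2 * 5 ^ t" using assms(2) by simp
  then have "p\<^sup>2 dvd (x * p)\<^sup>2 + y\<^sup>2" by simp
  then have "p\<^sup>2 dvd y\<^sup>2" by (simp add: power_mult_distrib dvd_add_right_iff)
  then obtain z where z: "y = p * z" by (auto elim: dvdE)
  have "p\<^sup>2 * (x\<^sup>2 + z\<^sup>2) = p\<^sup>2 * 5 ^ t" using xy unfolding z by (simp add: power_mult_distrib algebra_simps)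
  then have xz: "x\<^sup>2 + z\<^sup>2 = 5 ^ t" using p0 by simp
  have "odd (x\<^sup>2 + z\<^sup>2)" unfolding xz by simp
  moreover have "odd z" using y(1) z by simp
  ultimately have "even x" by simp
  then show ?R using xz x unfolding even_legs_def by blast
next
  assume ?R
  then obtain x z where x: "2 * n = q * x" "even x" "x\<^sup>2 + z\<^sup>2 = 5 ^ t"
    unfolding even_legs_def by blast
  have "odd (x\<^sup>2 + z\<^sup>2)" unfolding x(3) by simp
  then have "odd (p * z)" using x(2) assms(1) by simp
  moreover have "(2 * n * p)\<^sup>2 + (q * (p * z))\<^sup>2 = (q * p)\<^sup>2 * (x\<^sup>2 + z\<^sup>2)"
    unfolding x(1) by (simp add: power_mult_distrib algebra_simps)
  ultimately show ?L unfolding x(3) by blast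
qed

lemma Q_odd_pos_cases:
  assumes "r \<in> Q_odd_pos"
  obtains p q :: nat where "odd p" "q > 0" "coprime p q" "real_of_rat r = real p / real q"
proof -
  obtain a b where ab: "quotient_of r = (a, b)" by fastforce
  have b: "b > 0" using ab by (rule quotient_of_denom_pos)
  have co: "coprime a b" using ab by (rule quotient_of_coprime)
  have r: "r = of_int a / of_int b" using ab by (rule quotient_of_div)
  have "r > 0" "odd a" using assms ab unfolding Q_odd_pos_def by auto
  then have a: "a > 0" using r b by (simp add: zero_less_divide_iff)
  have "real_of_rat r = of_int a / of_int b" unfolding r by (simp add: of_rat_divide)
  then have "real_of_rat r = real (nat a) / real (nat b)" using a b by simp
  moreover have "coprime (nat a) (nat b)" using co a b by (simp add: coprime_int_iff[symmetric])
  moreover have "odd (nat a)" using \<open>odd a\<close> a by (simp add: even_nat_iff)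
  ultimately show thesis using that[of "nat a" "nat b"] b by simp
qed

theorem theorem3p10:
  fixes \<kappa> :: real and N :: nat
  assumes "\<kappa> \<in> (\<lambda>q. pi * real_of_rat q) ` Q_odd_pos"
    and "N \<ge> 1"
  shows "\<exists>\<Lambda>\<in>U. finite (M \<kappa> \<Lambda>) \<and> card (M \<kappa> \<Lambda>) = N \<and> 0 \<notin> M \<kappa> \<Lambda>"
proof -
  obtain p q :: nat where pq: "odd p" "q > 0" "coprime p q" and \<kappa>: "\<kappa> = pi * (real p / real q)"
    using assms(1) by (auto elim!: Q_odd_pos_cases)
  have p0: "p > 0" using pq(1) by (auto intro!: Nat.gr0I)
  define t where "t = 2 * (N - 1) + 1"
  have legs: "finite (even_legs t)" "card (even_legs t) = N" "0 \<notin> even_legs t"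
    using even_legs_odd_power[of "N - 1"] assms(2) unfolding t_def by auto
  define \<alpha> where "\<alpha> = - ((pi / 2 * real p)\<^sup>2 * 5 ^ t)"
  have "\<alpha> < 0" using p0 unfolding \<alpha>_def by simp
  then obtain \<mu> \<phi> where U: "(\<mu>, \<alpha>, \<phi>) \<in> U" and r: "r_ker (\<mu>, \<alpha>, \<phi>) = 0"
    by (rule r_ker_zero)
  \<comment> \<open>Both sides of the real equation carry the factor \<open>(pi / (2 q))\<^sup>2\<close>; what remains is an equation
    between natural numbers.\<close>
  have clear: "- \<alpha> = (real n)\<^sup>2 * \<kappa>\<^sup>2 + (pi / 2 * real y)\<^sup>2
      \<longleftrightarrow> (2 * n * p)\<^sup>2 + (q * y)\<^sup>2 = (q * p)\<^sup>2 * 5 ^ t" for n y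
  proof -
    have c: "(pi / (2 * real q))\<^sup>2 \<noteq> 0" using pq(2) by simp
    have e1: "- \<alpha> = (pi / (2 * real q))\<^sup>2 * real ((q * p)\<^sup>2 * 5 ^ t)"
      using pq(2) unfolding \<alpha>_def by (simp add: field_simps)
    have e2: "(real n)\<^sup>2 * \<kappa>\<^sup>2 + (pi / 2 * real y)\<^sup>2
        = (pi / (2 * real q))\<^sup>2 * real ((2 * n * p)\<^sup>2 + (q * y)\<^sup>2)"
      using pq(2) unfolding \<kappa> by (simp add: field_simps)
    show ?thesis unfolding e1 e2 mult_cancel_left of_nat_eq_iff using c by auto
  qed
  have M_iff: "n \<in> M \<kappa> (\<mu>, \<alpha>, \<phi>) \<longleftrightarrow> (\<exists>x\<in>even_legs t. 2 * n = q * x)" for n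
    using kernel_zero_iff[of \<kappa> n \<alpha>] rational_wavenumber_leg_iff[OF pq, of n t]
    unfolding M_def clear by (simp add: r)
  have ev: "even x" if "x \<in> even_legs t" for x using that unfolding even_legs_def by simp
  have M_eq: "M \<kappa> (\<mu>, \<alpha>, \<phi>) = (\<lambda>x. q * (x div 2)) ` even_legs t"
  proof (intro set_eqI)
    fix n
    have "2 * n = q * x \<longleftrightarrow> n = q * (x div 2)" if "x \<in> even_legs t" for x
      using ev[OF that] by (auto elim!: evenE)
    then show "n \<in> M \<kappa> (\<mu>, \<alpha>, \<phi>) \<longleftrightarrow> n \<in> (\<lambda>x. q * (x div 2)) ` even_legs t"
      unfolding M_iff by blast
  qed
  have "inj_on (\<lambda>x. q * (x div 2)) (even_legs t)"
    using pq(2) ev by (auto intro!: inj_onI elim!: evenE dest!: ev)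
  then have "card (M \<kappa> (\<mu>, \<alpha>, \<phi>)) = N" unfolding M_eq using legs by (simp add: card_image)
  moreover have "finite (M \<kappa> (\<mu>, \<alpha>, \<phi>))" unfolding M_eq using legs by simp
  moreover have "0 \<notin> M \<kappa> (\<mu>, \<alpha>, \<phi>)" unfolding M_iff using legs(3) pq(2) by auto
  ultimately show ?thesis using U by blast
qed

end
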